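(* Let $R$ be a ring. Then the following are equivalent: (1) $R$ is Zhou nil-clean. (2) For any $a\in R$, there exist a 2-idempotent $e\in \mathbb{Z}[a]$ and a nilpotent $w\in R$ such that $a^2=e+w$. (3) For any $a\in R$, $a^2$ is the sum of a 2-idempotent and a nilpotent that commute.
   Context: All rings are associative with an identity, not necessarily commutative. An element $t$ of a ring is tripotent if $t^3=t$. An element $e$ of a ring is a 2-idempotent if $e^2$ is an idempotent, i.e. $e^2=e^4$. A ring $R$ is Zhou nil-clean if every element of $R$ is the sum of two tripotents and a nilpotent that (pairwise) commute. For $a\in R$, $\mathbb{Z}[a]=\{f(a) : f(t)\text{ is a polynomial with integral coefficients}\}\subseteq R$. *)

theory Defs
  imports "HOL-Algebra.Ring" "HOL-Computational_Algebra.Polynomial"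
begin

definition ring_idempotent :: "('a, 'b) ring_scheme \<Rightarrow> 'a \<Rightarrow> bool" where
  "ring_idempotent R x \<longleftrightarrow> x \<in> carrier R \<and> x \<otimes>\<^bsub>R\<^esub> x = x"

definition ring_tripotent :: "('a, 'b) ring_scheme \<Rightarrow> 'a \<Rightarrow> bool" where
  "ring_tripotent R t \<longleftrightarrow> t \<in> carrier R \<and> t [^]\<^bsub>R\<^esub> (3::nat) = t"

definition ring_two_idempotent :: "('a, 'b) ring_scheme \<Rightarrow> 'a \<Rightarrow> bool" where
  "ring_two_idempotent R e \<longleftrightarrow> e \<in> carrier R \<and> ring_idempotent R (e [^]\<^bsub>R\<^esub> (2::nat))"

definition ring_nilpotent :: "('a, 'b) ring_scheme \<Rightarrow> 'a \<Rightarrow> bool" where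
  "ring_nilpotent R w \<longleftrightarrow> w \<in> carrier R \<and> (\<exists>n::nat. 0 < n \<and> w [^]\<^bsub>R\<^esub> n = \<zero>\<^bsub>R\<^esub>)"

definition ring_commute :: "('a, 'b) ring_scheme \<Rightarrow> 'a \<Rightarrow> 'a \<Rightarrow> bool" where
  "ring_commute R x y \<longleftrightarrow> x \<otimes>\<^bsub>R\<^esub> y = y \<otimes>\<^bsub>R\<^esub> x"

definition zhou_nil_clean :: "('a, 'b) ring_scheme \<Rightarrow> bool" where
  "zhou_nil_clean R \<longleftrightarrow>
     (\<forall>a \<in> carrier R. \<exists>p q w.
        ring_tripotent R p \<and> ring_tripotent R q \<and> ring_nilpotent R w \<and>
        ring_commute R p q \<and> ring_commute R p w \<and> ring_commute R q w \<and>
        a = p \<oplus>\<^bsub>R\<^esub> q \<oplus>\<^bsub>R\<^esub> w)"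

text \<open>Evaluation of a polynomial over the integers at an element of \<open>R\<close>;
  \<open>[k] \<cdot> x\<close> is the integer multiple \<open>k x\<close> (negative \<open>k\<close> allowed), so that the
  coefficients stay integers rather than elements of \<open>R\<close>.\<close>

definition int_poly_eval :: "('a, 'b) ring_scheme \<Rightarrow> int poly \<Rightarrow> 'a \<Rightarrow> 'a" where
  "int_poly_eval R f a =
     (\<Oplus>\<^bsub>R\<^esub>i \<in> {..degree f}. [coeff f i] \<cdot>\<^bsub>R\<^esub> (a [^]\<^bsub>R\<^esub> i))"

definition int_adjoin :: "('a, 'b) ring_scheme \<Rightarrow> 'a \<Rightarrow> 'a set" where
  "int_adjoin R a = {int_poly_eval R f a | f. True}"

end

theory Submission
  imports Defs
begin

text \<open>
  All three conditions are equivalent to: \<open>a\<^sup>5 - a\<close> is nilpotent for every \<open>a\<close>.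
  Modulo the nilpotents, this says that every commutative subring generated by one element is a
  reduced ring satisfying \<open>x\<^sup>5 = x\<close> identically, hence a subdirect product of copies of the fields
  with 2, 3 and 5 elements (the case \<open>x = 2\<close> gives \<open>30 = 0\<close>).

  \<^emph>\<open>To the fifth power condition.\<close> If \<open>t = p + q\<close> is a sum of commuting tripotents, then
  \<open>t\<close> is a root of \<open>t\<^sup>5 - 5t\<^sup>3 + 4t = (t - 2)(t - 1)t(t + 1)(t + 2)\<close>, because locally
  \<open>p\<close> and \<open>q\<close> take the values \<open>0\<close>, \<open>1\<close>, \<open>-1\<close>. For the element \<open>3\<close> of the ring, this
  makes \<open>120\<close>, and so \<open>30\<close>, nilpotent; and modulo \<open>30\<close> one gets that \<open>t\<^sup>5 - t\<close> is nilpotent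
  (\<open>nil_fifth_power_of_sum\<close>). If instead \<open>a\<^sup>2 = e + w\<close> with a commuting 2-idempotent and nilpotent,
  then \<open>a\<^sup>8 - a\<^sup>4\<close> is nilpotent since \<open>e\<^sup>4 = e\<^sup>2\<close>, and \<open>(a\<^sup>5 - a)\<^sup>4\<close> is a multiple of
  \<open>a\<^sup>8 - a\<^sup>4\<close>.

  \<^emph>\<open>From the fifth power condition.\<close> Interpolation over the three fields gives integer
  polynomials in \<open>a\<close> that form pairs of orthogonal idempotents modulo nilpotents. Idempotents lift
  modulo nilpotents inside \<open>\<int>[a]\<close>, orthogonality survives, and the difference of two orthogonal
  idempotents is a tripotent (\<open>tripotent_lift\<close>). One pair gives a tripotent \<open>e\<close> close to
  \<open>a\<^sup>2\<close> (\<open>square_near_tripotent\<close>), and tripotents are 2-idempotent; two pairs give tripotents with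
  sum close to \<open>a\<close> (\<open>near_sum_of_tripotents\<close>). Everything lies in \<open>\<int>[a]\<close> and so commutes.

  All computations concern finitely many commuting elements. They are carried out in a
  commutative ring \<open>'c\<close>, in practice an iterated polynomial ring over the integers, along a
  unital homomorphism \<open>h\<close> from \<open>'c\<close> to the noncommutative ring. There, a claim about nilpotency
  becomes membership in the ideal of all \<open>c\<close> with \<open>h c\<close> nilpotent, and is proved by writing an
  element explicitly as a combination of known members.
\<close>

section \<open>Homomorphisms from commutative rings\<close>

text \<open>
  The domain is a type, not a carrier set, so that ring identities in it can be decided by
  simplification. The kernel of \<open>h\<close> is handled as the set of solutions of \<open>h c = \<zero>\<close>; its radical is
  the predicate \<open>nil\<close> below.
\<close>

locale comm_eval = ring R
  for R :: "('a, 'b) ring_scheme" (structure)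
    and h :: "'c::comm_ring_1 \<Rightarrow> 'a" +
  assumes h_closed [simp, intro]: "h c \<in> carrier R"
    and h_add: "h (c + d) = h c \<oplus> h d"
    and h_mult: "h (c * d) = h c \<otimes> h d"
    and h_one: "h 1 = \<one>"
begin

lemma h_zero: "h 0 = \<zero>"
  using h_add[of 0 0] h_closed[of 0] by (metis add.r_cancel_one add_0)

lemma h_uminus: "h (- c) = \<ominus> h c"
  using h_add[of "- c" c] by (simp add: h_zero minus_equality)

lemma h_diff: "h (c - d) = h c \<ominus> h d"
  using h_add[of c "- d"] by (simp add: h_uminus minus_eq)

lemma h_power: "h (c ^ n) = h c [^] n"
  by (induction n) (simp_all add: h_one h_mult power_commutes[symmetric])

lemma h_commute: "h c \<otimes> h d = h d \<otimes> h c"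
  by (metis h_mult mult.commute)

lemma h_eq_iff: "h c = h d \<longleftrightarrow> h (c - d) = \<zero>"
proof
  assume "h (c - d) = \<zero>"
  then show "h c = h d" using h_add[of "c - d" d] by simp
qed (simp add: h_diff minus_eq r_neg)

lemma ker_add: "h c = \<zero> \<Longrightarrow> h d = \<zero> \<Longrightarrow> h (c + d) = \<zero>"
  by (simp add: h_add)

lemma ker_mult: "h d = \<zero> \<Longrightarrow> h (c * d) = \<zero>"
  by (simp add: h_mult)

lemma ker_dvd: "h c = \<zero> \<Longrightarrow> c dvd d \<Longrightarrow> h d = \<zero>"
  by (auto simp: dvd_def h_mult)

text \<open>An exponent \<open>n = 0\<close> does no harm: it forces \<open>\<one> = \<zero>\<close>, and then every element is nilpotent.\<close>

definition nil :: "'c \<Rightarrow> bool" where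
  "nil c \<longleftrightarrow> (\<exists>n. h (c ^ n) = \<zero>)"

lemma nil_iff: "nil c \<longleftrightarrow> ring_nilpotent R (h c)"
proof
  assume "nil c"
  then obtain n where "h (c ^ n) = \<zero>" by (auto simp: nil_def)
  then have "h (c ^ Suc n) = \<zero>" by (simp add: h_mult)
  then show "ring_nilpotent R (h c)"
    unfolding ring_nilpotent_def by (metis h_closed h_power zero_less_Suc)
next
  assume "ring_nilpotent R (h c)"
  then show "nil c" unfolding ring_nilpotent_def nil_def by (auto simp: h_power)
qed

lemma ker_nil: "h c = \<zero> \<Longrightarrow> nil c"
  unfolding nil_def by (metis power_one_right)

lemma nil_power: "nil (c ^ k) \<Longrightarrow> nil c"
  unfolding nil_def by (metis power_mult)

lemma nil_mult: "nil d \<Longrightarrow> nil (c * d)"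
  unfolding nil_def by (metis power_mult_distrib ker_mult)

lemma nil_dvd: "nil c \<Longrightarrow> c dvd d \<Longrightarrow> nil d"
  by (metis dvdE mult.commute nil_mult)

text \<open>In each term of the binomial expansion of \<open>(c + d) ^ (m + n)\<close>, \<open>c\<close> has exponent at least \<open>m\<close>
  or \<open>d\<close> has exponent at least \<open>n\<close>.\<close>

lemma nil_add:
  assumes "nil c" "nil d"
  shows "nil (c + d)"
proof -
  obtain m n where m: "h (c ^ m) = \<zero>" and n: "h (d ^ n) = \<zero>"
    using assms by (auto simp: nil_def)
  have "h (\<Sum>k\<in>A. of_nat (m + n choose k) * c ^ k * d ^ (m + n - k)) = \<zero>" if "finite A" for A
    using that
  proof (induction A rule: finite_induct)
    case (insert k A)
    have "c ^ m dvd c ^ k \<or> d ^ n dvd d ^ (m + n - k)"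
      by (cases "m \<le> k") (auto intro: le_imp_power_dvd)
    then have "h (of_nat (m + n choose k) * c ^ k * d ^ (m + n - k)) = \<zero>"
      using m n by (metis dvd_mult dvd_mult2 ker_dvd)
    then show ?case using insert by (simp add: ker_add)
  qed (simp add: h_zero)
  then have "h ((c + d) ^ (m + n)) = \<zero>"
    by (simp add: binomial_ring)
  then show ?thesis by (auto simp: nil_def)
qed

lemma nil_uminus: "nil c \<Longrightarrow> nil (- c)"
  using nil_mult[of c "- 1"] by simp

lemma nil_diff: "nil c \<Longrightarrow> nil d \<Longrightarrow> nil (c - d)"
  using nil_add[of c "- d"] nil_uminus by simp

section \<open>Lifting idempotents and tripotents\<close>

lemma dvd_one_minus_power: "y dvd 1 - (1 - y) ^ n" for y :: 'c
proof (induction n)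
  case (Suc n)
  have "1 - (1 - y) ^ Suc n = (1 - (1 - y) ^ n) + y * (1 - y) ^ n"
    by (simp add: algebra_simps)
  with Suc show ?case by (metis dvd_add dvd_triv_left)
qed simp

text \<open>
  With \<open>f ^ n * (1 - f) ^ n\<close> in the kernel, \<open>e = 1 - (1 - f ^ n) ^ n\<close> is the lift: it is
  divisible by \<open>f ^ n\<close>, and its complement by \<open>(1 - f) ^ n\<close>. That \<open>f\<close> divides \<open>e\<close> is what
  carries orthogonality over to the lifts.
\<close>

lemma idempotent_lift:
  assumes "nil (f\<^sup>2 - f)"
  obtains e where "h (e\<^sup>2 - e) = \<zero>" "nil (e - f)" "f dvd e"
proof -
  have "nil (f * (1 - f))"
    using nil_uminus[OF assms] by (simp add: algebra_simps power2_eq_square)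
  then obtain n where "h ((f * (1 - f)) ^ n) = \<zero>" by (auto simp: nil_def)
  \<comment> \<open>A positive exponent is needed for \<open>f\<close> to divide \<open>f ^ n\<close>.\<close>
  then have "h ((f * (1 - f)) ^ Suc n) = \<zero>" by (simp add: ker_mult)
  then obtain n where n: "n > 0" "h ((f * (1 - f)) ^ n) = \<zero>" by blast
  define e where "e = 1 - (1 - f ^ n) ^ n"
  have 1: "f ^ n dvd e" unfolding e_def by (rule dvd_one_minus_power)
  have "1 - f dvd 1 - f ^ n"
    using dvd_one_minus_power[of "1 - f" n] by simp
  then have 2: "(1 - f) ^ n dvd 1 - e" unfolding e_def by (simp add: dvd_power_same)
  have "h (e * (1 - e)) = \<zero>"
    using ker_dvd[OF n(2)] mult_dvd_mono[OF 1 2] by (simp add: power_mult_distrib)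
  then have a: "h (e\<^sup>2 - e) = \<zero>"
    using ker_mult[of "e * (1 - e)" "- 1"] by (simp add: algebra_simps power2_eq_square)
  have 3: "f dvd e" using 1 n(1) by (metis dvd_power dvd_trans)
  have 4: "1 - f dvd 1 - e" using 2 n(1) by (metis dvd_power dvd_trans)
  have "nil (e * (1 - f))" "nil (f * (1 - e))"
    using 3 4 \<open>nil (f * (1 - f))\<close> by (meson nil_dvd mult_dvd_mono dvd_refl)+
  then have "nil (e * (1 - f) - f * (1 - e))" by (rule nil_diff)
  then have "nil (e - f)" by (simp add: algebra_simps)
  with a 3 that show ?thesis by blast
qed

lemma idempotent_nil_eq_zero:
  assumes "h (e\<^sup>2 - e) = \<zero>" "nil e"
  shows "h e = \<zero>"
proof -
  have ee: "h e \<otimes> h e = h e"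
    using assms(1) by (simp add: power2_eq_square h_mult flip: h_eq_iff)
  have "h (e ^ Suc n) = h e" for n
    by (induction n) (simp_all add: h_mult ee)
  moreover obtain n where "h (e ^ n) = \<zero>" using assms(2) by (auto simp: nil_def)
  then have "h (e ^ Suc n) = \<zero>" by (simp add: h_mult)
  ultimately show ?thesis by simp
qed

text \<open>
  Lifting \<open>f\<close> and \<open>g\<close> separately gives idempotents \<open>d\<close> and \<open>e\<close> modulo the kernel. Their product
  is idempotent and nilpotent, hence zero, and the difference of orthogonal idempotents is tripotent.
  Lifting \<open>f - g\<close> directly as a root of \<open>t\<^sup>3 - t\<close> by Newton's method would need the
  derivative \<open>3t\<^sup>2 - 1\<close> to be invertible, which fails at characteristic 2.
\<close>

lemma tripotent_lift:
  assumes "nil (f\<^sup>2 - f)" "nil (g\<^sup>2 - g)" "nil (f * g)"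
  obtains t where "h (t ^ 3 - t) = \<zero>" "nil (t - (f - g))"
proof -
  obtain d where d: "h (d\<^sup>2 - d) = \<zero>" "nil (d - f)" "f dvd d"
    using idempotent_lift[OF assms(1)] by blast
  obtain e where e: "h (e\<^sup>2 - e) = \<zero>" "nil (e - g)" "g dvd e"
    using idempotent_lift[OF assms(2)] by blast
  have "nil (d * e)" using assms(3) d(3) e(3) by (meson nil_dvd mult_dvd_mono)
  moreover have "(d * e)\<^sup>2 - d * e = e\<^sup>2 * (d\<^sup>2 - d) + d * (e\<^sup>2 - e)"
    by (simp add: algebra_simps power_numeral_reduce)
  then have "h ((d * e)\<^sup>2 - d * e) = \<zero>"
    using d(1) e(1) by (simp add: ker_add ker_mult)
  ultimately have de: "h (d * e) = \<zero>" by (rule idempotent_nil_eq_zero[rotated])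
  have "(d - e) ^ 3 - (d - e)
      = (d + 1) * (d\<^sup>2 - d) + (- e - 1) * (e\<^sup>2 - e) + (3 * e - 3 * d) * (d * e)"
    by (simp add: algebra_simps power_numeral_reduce)
  then have 1: "h ((d - e) ^ 3 - (d - e)) = \<zero>"
    using d(1) e(1) de by (simp only: ker_add ker_mult)
  have "nil ((d - f) - (e - g))" using d(2) e(2) by (rule nil_diff)
  then have "nil ((d - e) - (f - g))" by (simp add: algebra_simps)
  with 1 that show ?thesis by blast
qed

section \<open>Sums of two tripotents and a nilpotent\<close>

text \<open>
  Put \<open>t = x + y\<close>. Reducing by \<open>x\<^sup>3 = x\<close> and \<open>y\<^sup>3 = y\<close> yields \<open>t\<^sup>3 = t + 3xyt\<close> and
  \<open>t\<^sup>5 = t + 15xyt\<close>, so \<open>t\<^sup>5 - 5t\<^sup>3 + 4t = 0\<close>. Moreover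
  \<open>(xyt)\<^sup>2 = 2(x\<^sup>2y\<^sup>2 + xy)\<close>, so \<open>(15xyt)\<^sup>2\<close> is a multiple of \<open>30\<close>. Replacing \<open>t\<close> by \<open>t + z\<close>
  changes these polynomials by a multiple of \<open>z\<close>.
\<close>

lemma nil_fifth_power_of_sum:
  assumes "h (x ^ 3 - x) = \<zero>" "h (y ^ 3 - y) = \<zero>" "nil z"
  defines "s \<equiv> x + y + z"
  shows "nil (s ^ 5 - 5 * s ^ 3 + 4 * s)" and "nil 30 \<Longrightarrow> nil (s ^ 5 - s)"
proof -
  define t where "t = x + y"
  have s: "s = t + z" by (simp add: s_def t_def)
  have x: "nil (x ^ 3 - x)" and y: "nil (y ^ 3 - y)" using assms ker_nil by auto
  have 3: "nil (t ^ 3 - t - 3 * x * y * t)"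
  proof -
    have "t ^ 3 - t - 3 * x * y * t = (x ^ 3 - x) + (y ^ 3 - y)"
      unfolding t_def by (simp add: algebra_simps power_numeral_reduce)
    with x y show ?thesis by (simp add: nil_add)
  qed
  have 5: "nil (t ^ 5 - t - 15 * x * y * t)"
  proof -
    have "t ^ 5 - t - 15 * x * y * t = (t\<^sup>2 + 3 * x * y + 1) * (t ^ 3 - t - 3 * x * y * t)
        + 9 * y\<^sup>2 * (x ^ 3 - x) + 9 * x\<^sup>2 * (y ^ 3 - y)"
      unfolding t_def by (simp add: algebra_simps power_numeral_reduce)
    with x y 3 show ?thesis by (simp only: nil_add nil_mult)
  qed
  have "t ^ 5 - 5 * t ^ 3 + 4 * t
      = (t ^ 5 - t - 15 * x * y * t) + (- 5) * (t ^ 3 - t - 3 * x * y * t)"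
    by (simp add: algebra_simps power_numeral_reduce)
  then have g: "nil (t ^ 5 - 5 * t ^ 3 + 4 * t)" using 3 5 by (simp only: nil_add nil_mult)
  have shift: "s ^ 5 - 5 * s ^ 3 + 4 * s = (t ^ 5 - 5 * t ^ 3 + 4 * t) +
      (5 * t ^ 4 + 10 * t ^ 3 * z + 10 * t\<^sup>2 * z\<^sup>2 + 5 * t * z ^ 3 + z ^ 4
        - 15 * t\<^sup>2 - 15 * t * z - 5 * z\<^sup>2 + 4) * z"
    unfolding s by (simp add: algebra_simps power_numeral_reduce)
  show "nil (s ^ 5 - 5 * s ^ 3 + 4 * s)"
    unfolding shift using g assms(3) by (simp only: nil_add nil_mult)
  assume 30: "nil 30"
  have "(15 * x * y * t)\<^sup>2 = 15 * (x\<^sup>2 * y\<^sup>2 + x * y) * 30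
      + (225 * x * y\<^sup>2) * (x ^ 3 - x) + (225 * x\<^sup>2 * y) * (y ^ 3 - y)
      + (450 * y ^ 3) * (x ^ 3 - x) + (450 * x) * (y ^ 3 - y)"
    unfolding t_def by (simp add: algebra_simps power_numeral_reduce)
  then have "nil (15 * x * y * t)"
    using 30 x y nil_power[of "15 * x * y * t" 2] by (simp only: nil_add nil_mult)
  with 5 have "nil ((t ^ 5 - t - 15 * x * y * t) + 15 * x * y * t)" by (rule nil_add)
  then have "nil (t ^ 5 - t)" by simp
  moreover have "s ^ 5 - s = (t ^ 5 - t) +
      (5 * t ^ 4 + 10 * t ^ 3 * z + 10 * t\<^sup>2 * z\<^sup>2 + 5 * t * z ^ 3 + z ^ 4 - 1) * z"
    unfolding s by (simp add: algebra_simps power_numeral_reduce)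
  ultimately show "nil (s ^ 5 - s)" using assms(3) by (simp only: nil_add nil_mult)
qed

section \<open>Interpolation over the fields with 2, 3 and 5 elements\<close>

text \<open>
  Modulo nilpotents, \<open>30 = 0\<close> splits the ring into parts of characteristic 2, 3 and 5, where
  \<open>x\<close> must satisfy \<open>x\<^sup>2 = x\<close>, \<open>x\<^sup>3 = x\<close> and \<open>x\<^sup>5 = x\<close>. The factors \<open>15\<close> and \<open>10\<close> in the two
  lemmas below project to the first two parts. Together, these relations put into the radical
  every integer polynomial in \<open>x\<close> that vanishes as a function on each of the three prime fields.
\<close>

context
  fixes x :: 'c
  assumes nil_30: "nil 30"
    and nil_x5: "nil (x ^ 5 - x)"
    and nil_x5_shift: "nil ((x + 1) ^ 5 - (x + 1))"
begin

text \<open>Modulo 2, \<open>x\<^sup>5 - x = x(x - 1)\<^sup>4\<close> has the same prime factors as \<open>x\<^sup>2 - x\<close>.\<close>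

lemma nil_mod_2: "nil (15 * (x\<^sup>2 - x))"
proof -
  have "(15 * (x\<^sup>2 - x)) ^ 4
      = 15 ^ 4 * x ^ 3 * (x ^ 5 - x) + 15 ^ 3 * x ^ 3 * (- 2 * x ^ 4 + 3 * x ^ 3 - 2 * x\<^sup>2 + x) * 30"
    by (simp add: algebra_simps power_numeral_reduce)
  then have "nil ((15 * (x\<^sup>2 - x)) ^ 4)"
    using nil_30 nil_x5 by (simp only: nil_add nil_mult)
  then show ?thesis by (rule nil_power)
qed

text \<open>
  Modulo 3, \<open>x\<^sup>5 - x = (x\<^sup>3 - x)(x\<^sup>2 + 1)\<close>, and the factor \<open>x\<^sup>2 + 1\<close> is irreducible; the relation
  for \<open>x + 1\<close> removes it. Indeed the two relations differ by
  \<open>5x(x + 1)(x\<^sup>2 + x + 1)\<close>, where \<open>x\<^sup>2 + x + 1 = (x - 1)\<^sup>2\<close> modulo 3.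
\<close>

lemma nil_mod_3: "nil (10 * (x ^ 3 - x))"
proof -
  have "(10 * (x ^ 3 - x))\<^sup>2
      = (20 * x * (x + 1)) * ((x + 1) ^ 5 - (x + 1))
        + (- (20 * x * (x + 1))) * (x ^ 5 - x) + (- 10 * x\<^sup>2 * (x + 1)\<^sup>2 * x) * 30"
    by (simp add: algebra_simps power_numeral_reduce)
  then have "nil ((10 * (x ^ 3 - x))\<^sup>2)"
    using nil_30 nil_x5 nil_x5_shift by (simp only: nil_add nil_mult)
  then show ?thesis by (rule nil_power)
qed

lemmas nil_basis = nil_30 nil_x5 nil_mod_2 nil_mod_3

text \<open>
  On the three prime fields, a square \<open>b\<close> takes only the values \<open>0\<close>, \<open>1\<close> and, in characteristic 5,
  \<open>-1\<close>. The polynomial \<open>f\<close> is the indicator of \<open>b = 1\<close>, and \<open>g\<close> is that of \<open>b = -1\<close> in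
  characteristic 5 and vanishes in the others; their difference is exactly \<open>b\<close>.
\<close>

lemma square_near_tripotent:
  obtains e where "h (e ^ 3 - e) = \<zero>" "nil (x\<^sup>2 - e)"
proof -
  define b where "b = x\<^sup>2"
  define f where "f = 3 * b\<^sup>2 - 2 * b"
  define g where "g = 3 * b\<^sup>2 - 3 * b"
  have "f\<^sup>2 - f = (9 * b - 12) * x * (x ^ 5 - x) + x * (10 * (x ^ 3 - x))"
    unfolding f_def b_def by (simp add: algebra_simps power_numeral_reduce)
  then have f: "nil (f\<^sup>2 - f)" using nil_basis by (simp only: nil_add nil_mult)
  have "g\<^sup>2 - g = (9 * b - 18) * x * (x ^ 5 - x) + (x\<^sup>2 + x) * (15 * (x\<^sup>2 - x))"
    unfolding g_def b_def by (simp add: algebra_simps power_numeral_reduce)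
  then have g: "nil (g\<^sup>2 - g)" using nil_basis by (simp only: nil_add nil_mult)
  have "f * g = (9 * b - 15) * x * (x ^ 5 - x) + (x\<^sup>2 + x) * (15 * (x\<^sup>2 - x))"
    unfolding f_def g_def b_def by (simp add: algebra_simps power_numeral_reduce)
  then have fg: "nil (f * g)" using nil_basis by (simp only: nil_add nil_mult)
  obtain e where e: "h (e ^ 3 - e) = \<zero>" "nil (e - (f - g))"
    using tripotent_lift[OF f g fg] by blast
  have "x\<^sup>2 - e = - (e - (f - g))" by (simp add: f_def g_def b_def)
  with e that nil_uminus show ?thesis by metis
qed

text \<open>
  In characteristic 2 and 3, \<open>x\<close> takes only the values \<open>0\<close>, \<open>1\<close>, \<open>-1\<close> and is itself tripotent;
  in characteristic 5, the values \<open>2\<close> and \<open>-2\<close> are split as \<open>1 + 1\<close> and \<open>-1 - 1\<close>. Accordingly,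
  \<open>g1\<close> and \<open>g2\<close> are the indicators of \<open>2\<close> and \<open>-2\<close> in characteristic 5 and vanish in the others.
  The polynomial \<open>f1\<close> is the indicator of \<open>{1, 2}\<close> in characteristic 5 and of \<open>1\<close> otherwise;
  \<open>f2\<close> is that of \<open>{-1, -2}\<close> in characteristic 5, of \<open>-1\<close> in characteristic 3, and vanishes in
  characteristic 2. The coefficients are chosen, within their classes modulo 30,
  such that \<open>(f1 - f2) + (g1 - g2) = x\<close> exactly.
\<close>

lemma near_sum_of_tripotents:
  obtains p q where "h (p ^ 3 - p) = \<zero>" "h (q ^ 3 - q) = \<zero>" "nil (x - (p + q))"
proof -
  define f1 where "f1 = 11 * x - 10 * x\<^sup>2 + 12 * x ^ 3 - 12 * x ^ 4"
  define f2 where "f2 = 4 * x - 10 * x\<^sup>2 + 18 * x ^ 3 - 12 * x ^ 4"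
  define g1 where "g1 = - 18 * x + 6 * x\<^sup>2 + 18 * x ^ 3 - 6 * x ^ 4"
  define g2 where "g2 = - 12 * x + 6 * x\<^sup>2 + 12 * x ^ 3 - 6 * x ^ 4"
  \<comment> \<open>In the next identities, division by \<open>x ^ 5 - x\<close> leaves a remainder of degree at most 4 that
    vanishes as a function on the three prime fields, so its coefficients are divisible by 5; what
    is left modulo 6 is accounted for by the relations in characteristic 2 and 3.\<close>
  have "f1\<^sup>2 - f1 = (144 * x ^ 3 - 288 * x\<^sup>2 + 384 * x - 504) * (x ^ 5 - x)
      + 1 * (15 * (x\<^sup>2 - x)) + (x - 1) * (10 * (x ^ 3 - x))
      + (17 * x ^ 4 - 17 * x ^ 3 + 17 * x\<^sup>2 - 17 * x) * 30"
    unfolding f1_def by (simp add: algebra_simps power_numeral_reduce)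
  then have f1: "nil (f1\<^sup>2 - f1)" using nil_basis by (simp only: nil_add nil_mult)
  have "f2\<^sup>2 - f2 = (144 * x ^ 3 - 432 * x\<^sup>2 + 564 * x - 456) * (x ^ 5 - x)
      + (x + 1) * (10 * (x ^ 3 - x)) + (13 * x ^ 4 - 18 * x ^ 3 + 20 * x\<^sup>2 - 15 * x) * 30"
    unfolding f2_def by (simp add: algebra_simps power_numeral_reduce)
  then have f2: "nil (f2\<^sup>2 - f2)" using nil_basis by (simp only: nil_add nil_mult)
  have "f1 * f2 = (144 * x ^ 3 - 360 * x\<^sup>2 + 456 * x - 480) * (x ^ 5 - x)
      + x * (10 * (x ^ 3 - x)) + (16 * x ^ 4 - 17 * x ^ 3 + 17 * x\<^sup>2 - 16 * x) * 30"
    unfolding f1_def f2_def by (simp add: algebra_simps power_numeral_reduce)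
  then have f12: "nil (f1 * f2)" using nil_basis by (simp only: nil_add nil_mult)
  have "g1\<^sup>2 - g1 = (36 * x ^ 3 - 216 * x\<^sup>2 + 252 * x + 432) * (x ^ 5 - x)
      + (- 19 * x ^ 4 - 15 * x ^ 3 + 19 * x\<^sup>2 + 15 * x) * 30"
    unfolding g1_def by (simp add: algebra_simps power_numeral_reduce)
  then have g1: "nil (g1\<^sup>2 - g1)" using nil_basis by (simp only: nil_add nil_mult)
  have "g2\<^sup>2 - g2 = (36 * x ^ 3 - 144 * x\<^sup>2 + 72 * x + 288) * (x ^ 5 - x)
      + (- 7 * x ^ 4 - 10 * x ^ 3 + 7 * x\<^sup>2 + 10 * x) * 30"
    unfolding g2_def by (simp add: algebra_simps power_numeral_reduce)
  then have g2: "nil (g2\<^sup>2 - g2)" using nil_basis by (simp only: nil_add nil_mult)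
  have "g1 * g2 = (36 * x ^ 3 - 180 * x\<^sup>2 + 144 * x + 360) * (x ^ 5 - x)
      + (- 12 * x ^ 4 - 12 * x ^ 3 + 12 * x\<^sup>2 + 12 * x) * 30"
    unfolding g1_def g2_def by (simp add: algebra_simps power_numeral_reduce)
  then have g12: "nil (g1 * g2)" using nil_basis by (simp only: nil_add nil_mult)
  obtain p where p: "h (p ^ 3 - p) = \<zero>" "nil (p - (f1 - f2))"
    using tripotent_lift[OF f1 f2 f12] by blast
  obtain q where q: "h (q ^ 3 - q) = \<zero>" "nil (q - (g1 - g2))"
    using tripotent_lift[OF g1 g2 g12] by blast
  have "x = (f1 - f2) + (g1 - g2)"
    unfolding f1_def f2_def g1_def g2_def by (simp add: algebra_simps power_numeral_reduce)
  then have "x - (p + q) = - ((p - (f1 - f2)) + (q - (g1 - g2)))"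
    by (simp add: algebra_simps)
  with p q that nil_uminus nil_add show ?thesis by metis
qed

end

end

section \<open>Evaluation of polynomials at commuting elements\<close>

text \<open>
  Polynomials over \<open>'c\<close> are evaluated at an element that commutes with the image of \<open>h\<close>. Iterating
  this from the integers yields a homomorphism from a commutative ring that reaches any given
  finite family of commuting elements.
\<close>

definition poly_extend :: "('a, 'b) ring_scheme \<Rightarrow> ('c::zero \<Rightarrow> 'a) \<Rightarrow> 'a \<Rightarrow> 'c poly \<Rightarrow> 'a" where
  "poly_extend R h x f = (\<Oplus>\<^bsub>R\<^esub>i \<in> {..degree f}. h (coeff f i) \<otimes>\<^bsub>R\<^esub> x [^]\<^bsub>R\<^esub> i)"

context comm_eval
begin

context
  fixes x
  assumes x [simp]: "x \<in> carrier R"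
    and x_commute: "\<And>c. x \<otimes> h c = h c \<otimes> x"
begin

lemma poly_extend_closed [simp]: "poly_extend R h x f \<in> carrier R"
  unfolding poly_extend_def by (rule finsum_closed) auto

lemma poly_extend_0 [simp]: "poly_extend R h x 0 = \<zero>"
  by (simp add: poly_extend_def h_zero)

text \<open>Horner's rule, which reduces the homomorphism laws to structural induction on polynomials.\<close>

lemma poly_extend_pCons: "poly_extend R h x (pCons c f) = h c \<oplus> poly_extend R h x f \<otimes> x"
proof (cases "f = 0")
  case True
  then show ?thesis by (simp add: poly_extend_def h_zero)
next
  case False
  then show ?thesis
    by (simp add: poly_extend_def finsum_Suc2 Pi_def finsum_ldistr m_assoc a_comm
          del: finsum_Suc)
qed

lemma poly_extend_const [simp]: "poly_extend R h x [:c:] = h c"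
  by (simp add: poly_extend_pCons)

lemma poly_extend_X [simp]: "poly_extend R h x [:0, 1:] = x"
  by (simp add: poly_extend_pCons h_zero h_one)

lemma poly_extend_add:
  "poly_extend R h x (f + g) = poly_extend R h x f \<oplus> poly_extend R h x g"
  by (induction f g rule: poly_induct2) (simp_all add: poly_extend_pCons h_add l_distr a_ac)

text \<open>This makes the construction iterable: a further element commuting with everything so far also
  commutes with the enlarged image.\<close>

lemma poly_extend_commute:
  assumes y: "y \<in> carrier R" "y \<otimes> x = x \<otimes> y" "\<And>c. y \<otimes> h c = h c \<otimes> y"
  shows "y \<otimes> poly_extend R h x f = poly_extend R h x f \<otimes> y"
proof (induction f)
  case (pCons c f)
  then show ?case using y
    by (simp add: poly_extend_pCons l_distr r_distr) (metis m_assoc poly_extend_closed x)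
qed (use y in simp)

lemma poly_extend_smult: "poly_extend R h x (smult c f) = h c \<otimes> poly_extend R h x f"
  by (induction f) (simp_all add: poly_extend_pCons h_mult r_distr m_assoc)

lemma poly_extend_mult:
  "poly_extend R h x (f * g) = poly_extend R h x f \<otimes> poly_extend R h x g"
proof (induction f)
  case (pCons c f)
  have "poly_extend R h x g \<otimes> x = x \<otimes> poly_extend R h x g"
    using poly_extend_commute[of x] x_commute by simp
  then show ?case using pCons.IH
    by (simp add: poly_extend_pCons poly_extend_add poly_extend_smult h_zero l_distr m_assoc)
qed simp

lemma comm_eval_poly_extend: "comm_eval R (poly_extend R h x)"
  by unfold_locales
    (simp_all add: poly_extend_add poly_extend_mult one_pCons h_one)

end

end

context ring
begin

lemma comm_eval_int: "comm_eval R (\<lambda>k::int. [k] \<cdot> \<one>)"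
  by unfold_locales
    (simp_all add: add.int_pow_mult add_pow_ldistr_int add.int_pow_pow mult.commute)

lemma add_pow_one_commute: "a \<in> carrier R \<Longrightarrow> a \<otimes> ([(k::int)] \<cdot> \<one>) = ([k] \<cdot> \<one>) \<otimes> a"
  by (simp add: add_pow_ldistr_int add_pow_rdistr_int)

lemma poly_extend_int:
  assumes a: "a \<in> carrier R"
  shows "poly_extend R (\<lambda>k. [k] \<cdot> \<one>) a f = int_poly_eval R f a"
  unfolding poly_extend_def int_poly_eval_def
  using a by (intro finsum_cong') (auto simp: add_pow_ldistr_int)

lemma comm_eval_int_poly:
  assumes "a \<in> carrier R"
  shows "comm_eval R (\<lambda>f. int_poly_eval R f a)" and "int_poly_eval R [:0, 1:] a = a"
    and "\<And>b. b \<in> carrier R \<Longrightarrow> b \<otimes> a = a \<otimes> b \<Longrightarrow>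
      b \<otimes> int_poly_eval R f a = int_poly_eval R f a \<otimes> b"
proof -
  interpret int: comm_eval R "\<lambda>k::int. [k] \<cdot> \<one>" by (rule comm_eval_int)
  note c = assms add_pow_one_commute[OF assms]
  show "comm_eval R (\<lambda>f. int_poly_eval R f a)"
    using int.comm_eval_poly_extend[OF c] unfolding poly_extend_int[OF assms, abs_def] .
  show "int_poly_eval R [:0, 1:] a = a"
    using int.poly_extend_X[OF c] by (simp add: poly_extend_int assms)
  fix b assume "b \<in> carrier R" "b \<otimes> a = a \<otimes> b"
  then show "b \<otimes> int_poly_eval R f a = int_poly_eval R f a \<otimes> b"
    using int.poly_extend_commute[OF c, of b f]
    by (simp add: poly_extend_int assms add_pow_one_commute)
qed

lemma commuting_triple_eval:
  assumes x: "x \<in> carrier R" and y: "y \<in> carrier R" and z: "z \<in> carrier R"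
    and comm: "x \<otimes> y = y \<otimes> x" "x \<otimes> z = z \<otimes> x" "y \<otimes> z = z \<otimes> y"
  obtains h :: "int poly poly poly \<Rightarrow> 'a" and X Y Z
    where "comm_eval R h" "h X = x" "h Y = y" "h Z = z"
proof -
  define h1 where "h1 = (\<lambda>f. int_poly_eval R f x)"
  interpret h1: comm_eval R h1 unfolding h1_def by (rule comm_eval_int_poly(1)[OF x])
  have h1: "h1 [:0, 1:] = x" unfolding h1_def by (rule comm_eval_int_poly(2)[OF x])
  have y1: "y \<otimes> h1 c = h1 c \<otimes> y" and z1: "z \<otimes> h1 c = h1 c \<otimes> z" for c
    unfolding h1_def using comm_eval_int_poly(3)[OF x] y z comm by auto
  define h2 where "h2 = poly_extend R h1 y"
  interpret h2: comm_eval R h2 unfolding h2_def by (rule h1.comm_eval_poly_extend[OF y y1])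
  have z2: "z \<otimes> h2 c = h2 c \<otimes> z" for c
    unfolding h2_def using h1.poly_extend_commute[OF y y1 z] comm z1 by simp
  have "h2 [:0, 1:] = y" "h2 [:[:0, 1:]:] = x"
    unfolding h2_def using h1 h1.poly_extend_X[OF y y1] h1.poly_extend_const[OF y y1] by auto
  moreover have "comm_eval R (poly_extend R h2 z)" by (rule h2.comm_eval_poly_extend[OF z z2])
  moreover note h2.poly_extend_X[OF z z2] h2.poly_extend_const[OF z z2]
  ultimately show ?thesis using that by metis
qed

section \<open>The fifth power condition\<close>

definition fifth_power_nil :: bool where
  "fifth_power_nil \<longleftrightarrow> (\<forall>a \<in> carrier R. ring_nilpotent R (a [^] (5::nat) \<ominus> a))"

end

lemma (in comm_eval) h_of_int: "h (of_int k) = [k] \<cdot> \<one>"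
proof -
  have nat: "h (of_nat n) = [n] \<cdot> \<one>" for n
    by (induction n) (simp_all add: h_zero h_add h_one a_comm)
  show ?thesis
  proof (cases "k \<ge> 0")
    case True
    then show ?thesis using nat[of "nat k"] by (simp add: add_pow_int_ge)
  next
    case False
    then show ?thesis
      using arg_cong[OF nat[of "nat (- k)"], of "a_inv R"] by (simp add: add_pow_int_lt h_uminus)
  qed
qed

lemma (in comm_eval) h_numeral: "h (numeral k) = [(numeral k :: int)] \<cdot> \<one>"
  using h_of_int[of "numeral k"] by simp

lemma (in comm_eval) tripotent_iff: "ring_tripotent R (h c) \<longleftrightarrow> h (c ^ 3 - c) = \<zero>"
  by (simp add: ring_tripotent_def h_eq_iff[symmetric] h_power)

lemma (in comm_eval) two_idempotent_iff:
  "ring_two_idempotent R (h c) \<longleftrightarrow> h (c ^ 4 - c\<^sup>2) = \<zero>"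
proof -
  have "h (c ^ 4) = h c [^] (2::nat) \<otimes> h c [^] (2::nat)"
    by (simp flip: h_power h_mult power_add)
  then show ?thesis
    by (simp add: ring_two_idempotent_def ring_idempotent_def h_power flip: h_eq_iff)
qed

context ring
begin

lemma sum_of_tripotents_eval:
  assumes "zhou_nil_clean R" and "a \<in> carrier R"
  obtains h :: "int poly poly poly \<Rightarrow> 'a" and s where "comm_eval R h" "h s = a"
    "comm_eval.nil R h (s ^ 5 - 5 * s ^ 3 + 4 * s)"
    "comm_eval.nil R h 30 \<Longrightarrow> comm_eval.nil R h (s ^ 5 - s)"
proof -
  obtain p q w where *: "ring_tripotent R p" "ring_tripotent R q" "ring_nilpotent R w"
      "ring_commute R p q" "ring_commute R p w" "ring_commute R q w" "a = p \<oplus> q \<oplus> w"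
    using assms unfolding zhou_nil_clean_def by blast
  then obtain h :: "int poly poly poly \<Rightarrow> 'a" and x y z
    where h: "comm_eval R h" "h x = p" "h y = q" "h z = w"
    using commuting_triple_eval[of p q w]
    unfolding ring_commute_def ring_tripotent_def ring_nilpotent_def by metis
  interpret comm_eval R h by (rule h(1))
  have "h (x ^ 3 - x) = \<zero>" "h (y ^ 3 - y) = \<zero>" "nil z"
    using * h by (simp_all add: nil_iff flip: tripotent_iff)
  note nil_fifth_power_of_sum[OF this]
  moreover have "h (x + y + z) = a" by (simp add: h_add h *)
  ultimately show ?thesis using that h(1) by blast
qed

text \<open>
  The polynomial \<open>s\<^sup>5 - 5s\<^sup>3 + 4s\<close> has value \<open>120\<close> at \<open>3\<close>, and \<open>30\<^sup>3 = 225 * 120\<close>. So the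
  decomposition of the element \<open>3\<close> makes \<open>30\<close> nilpotent. The decompositions of \<open>3\<close> and of
  \<open>a\<close> live over different homomorphisms, which agree on integers by \<open>h_numeral\<close>.
\<close>

lemma zhou_nil_clean_imp_fifth_power_nil:
  assumes "zhou_nil_clean R"
  shows fifth_power_nil
  unfolding fifth_power_nil_def
proof
  have 30: "ring_nilpotent R ([(30::int)] \<cdot> \<one>)"
  proof -
    obtain h :: "int poly poly poly \<Rightarrow> 'a" and s where h: "comm_eval R h" "h s = [(3::int)] \<cdot> \<one>"
      "comm_eval.nil R h (s ^ 5 - 5 * s ^ 3 + 4 * s)"
      by (rule sum_of_tripotents_eval[OF assms, of "[(3::int)] \<cdot> \<one>"]) simp_all
    interpret comm_eval R h by (rule h(1))
    have "h (s - 3) = \<zero>" using h(2) by (simp add: h_numeral flip: h_eq_iff)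
    then have "nil (s - 3)" by (rule ker_nil)
    moreover have "30 ^ 3 = 225 * (s ^ 5 - 5 * s ^ 3 + 4 * s)
        + (- 225 * (s ^ 4 + 3 * s ^ 3 + 4 * s\<^sup>2 + 12 * s + 40)) * (s - 3)"
      by (simp add: algebra_simps power_numeral_reduce)
    ultimately have "nil (30 ^ 3)" using h(3) by (simp only: nil_add nil_mult)
    then have "nil 30" by (rule nil_power)
    then show ?thesis by (simp add: nil_iff h_numeral)
  qed
  fix a assume "a \<in> carrier R"
  then obtain h :: "int poly poly poly \<Rightarrow> 'a" and s where h: "comm_eval R h" "h s = a"
    "comm_eval.nil R h 30 \<Longrightarrow> comm_eval.nil R h (s ^ 5 - s)"
    using sum_of_tripotents_eval[OF assms] by metis
  interpret comm_eval R h by (rule h(1))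
  show "ring_nilpotent R (a [^] (5::nat) \<ominus> a)"
    using h(3) 30 by (simp add: nil_iff h_numeral h_diff h_power h(2))
qed

text \<open>
  Nothing forces \<open>e\<close> to commute with \<open>a\<close>, only with \<open>a\<^sup>2 = e + w\<close>. So the nilpotency of
  \<open>a\<^sup>8 - a\<^sup>4\<close> is computed from \<open>e\<close> and \<open>w\<close>, and only then is \<open>a\<^sup>5 - a\<close> treated in \<open>\<int>[a]\<close>.
\<close>

lemma square_decomposition_imp_fifth_power_nil:
  assumes "\<forall>a \<in> carrier R. \<exists>e w. ring_two_idempotent R e \<and> ring_nilpotent R w \<and>
             ring_commute R e w \<and> a [^] (2::nat) = e \<oplus> w"
  shows fifth_power_nil
  unfolding fifth_power_nil_def
proof
  fix a assume a: "a \<in> carrier R"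
  then obtain e w where ew: "ring_two_idempotent R e" "ring_nilpotent R w"
      "ring_commute R e w" "a [^] (2::nat) = e \<oplus> w"
    using assms by blast
  then obtain h :: "int poly poly poly \<Rightarrow> 'a" and x z where h: "comm_eval R h" "h x = e" "h z = w"
    using commuting_triple_eval[of e w \<zero>]
    unfolding ring_commute_def ring_two_idempotent_def ring_nilpotent_def
    by (metis l_null r_null zero_closed)
  have "ring_nilpotent R (a [^] (8::nat) \<ominus> a [^] (4::nat))"
  proof -
    interpret comm_eval R h by (rule h(1))
    have "nil (x ^ 4 - x\<^sup>2)" using ew(1) by (simp add: ker_nil h(2) flip: two_idempotent_iff)
    moreover have "nil z" using ew(2) h(3) by (simp add: nil_iff)
    moreover have "(x + z) ^ 4 - (x + z)\<^sup>2 = (x ^ 4 - x\<^sup>2)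
        + (4 * x ^ 3 + 6 * x\<^sup>2 * z + 4 * x * z\<^sup>2 + z ^ 3 - 2 * x - z) * z"
      by (simp add: algebra_simps power_numeral_reduce)
    ultimately have "nil ((x + z) ^ 4 - (x + z)\<^sup>2)" by (simp only: nil_add nil_mult)
    moreover have "h (x + z) = a [^] (2::nat)" by (simp add: h_add h ew)
    ultimately show ?thesis using a by (simp add: nil_iff h_diff h_power nat_pow_pow)
  qed
  moreover
  interpret comm_eval R "\<lambda>f. int_poly_eval R f a" by (rule comm_eval_int_poly(1)[OF a])
  define x :: "int poly" where "x = [:0, 1:]"
  have x: "int_poly_eval R x a = a" unfolding x_def by (rule comm_eval_int_poly(2)[OF a])
  ultimately have "nil (x ^ 8 - x ^ 4)" by (simp add: nil_iff h_diff h_power x)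
  moreover have "(x ^ 5 - x) ^ 4 = (x ^ 4 - 1) ^ 3 * (x ^ 8 - x ^ 4)"
    by (simp add: algebra_simps power_numeral_reduce)
  ultimately have "nil (x ^ 5 - x)" using nil_power[of "x ^ 5 - x" 4] by (simp only: nil_mult)
  then show "ring_nilpotent R (a [^] (5::nat) \<ominus> a)" by (simp add: nil_iff h_diff h_power x)
qed

end

lemma (in comm_eval) fifth_power_nilD:
  assumes fifth_power_nil
  shows "nil (c ^ 5 - c)" and "nil 30"
proof -
  show *: "nil (c ^ 5 - c)" for c
    using assms by (simp add: fifth_power_nil_def nil_iff h_diff h_power)
  show "nil 30" using *[of 2] by simp
qed

context ring
begin

lemma fifth_power_nil_imp_zhou_nil_clean:
  assumes fifth_power_nil
  shows "zhou_nil_clean R"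
  unfolding zhou_nil_clean_def
proof
  fix a assume a: "a \<in> carrier R"
  interpret comm_eval R "\<lambda>f. int_poly_eval R f a" by (rule comm_eval_int_poly(1)[OF a])
  define x :: "int poly" where "x = [:0, 1:]"
  have x: "int_poly_eval R x a = a" unfolding x_def by (rule comm_eval_int_poly(2)[OF a])
  obtain p q where pq: "int_poly_eval R (p ^ 3 - p) a = \<zero>" "int_poly_eval R (q ^ 3 - q) a = \<zero>"
      "nil (x - (p + q))"
    using near_sum_of_tripotents[of x] fifth_power_nilD[OF assms] by metis
  let ?p = "int_poly_eval R p a" and ?q = "int_poly_eval R q a"
    and ?w = "int_poly_eval R (x - (p + q)) a"
  have "a = int_poly_eval R (p + q + (x - (p + q))) a" by (simp add: x)
  then have "a = ?p \<oplus> ?q \<oplus> ?w" by (simp only: h_add)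
  moreover have "ring_tripotent R ?p" "ring_tripotent R ?q" using pq by (simp_all add: tripotent_iff)
  moreover have "ring_nilpotent R ?w" using pq by (simp only: nil_iff)
  ultimately show "\<exists>p q w. ring_tripotent R p \<and> ring_tripotent R q \<and> ring_nilpotent R w \<and>
      ring_commute R p q \<and> ring_commute R p w \<and> ring_commute R q w \<and> a = p \<oplus> q \<oplus> w"
    using h_commute unfolding ring_commute_def by blast
qed

lemma fifth_power_nil_imp_square_decomposition:
  assumes fifth_power_nil and a: "a \<in> carrier R"
  shows "\<exists>e w. e \<in> int_adjoin R a \<and> ring_two_idempotent R e \<and> ring_nilpotent R w \<and>
           a [^] (2::nat) = e \<oplus> w"
proof -
  interpret comm_eval R "\<lambda>f. int_poly_eval R f a" by (rule comm_eval_int_poly(1)[OF a])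
  define x :: "int poly" where "x = [:0, 1:]"
  have x: "int_poly_eval R x a = a" unfolding x_def by (rule comm_eval_int_poly(2)[OF a])
  obtain e where e: "int_poly_eval R (e ^ 3 - e) a = \<zero>" "nil (x\<^sup>2 - e)"
    using square_near_tripotent[of x] fifth_power_nilD[OF assms(1)] by metis
  let ?e = "int_poly_eval R e a" and ?w = "int_poly_eval R (x\<^sup>2 - e) a"
  have "e ^ 4 - e\<^sup>2 = e * (e ^ 3 - e)" by (simp add: algebra_simps power_numeral_reduce)
  then have "int_poly_eval R (e ^ 4 - e\<^sup>2) a = \<zero>" using e(1) by (simp only: ker_mult)
  then have "ring_two_idempotent R ?e" by (simp only: two_idempotent_iff)
  moreover have "?e \<in> int_adjoin R a" by (auto simp: int_adjoin_def)
  moreover have "ring_nilpotent R ?w" using e by (simp only: nil_iff)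
  moreover have "a [^] (2::nat) = int_poly_eval R (e + (x\<^sup>2 - e)) a" by (simp add: h_power x)
  then have "a [^] (2::nat) = ?e \<oplus> ?w" by (simp only: h_add)
  ultimately show ?thesis by blast
qed

lemma commute_of_int_adjoin:
  assumes a: "a \<in> carrier R" and e: "e \<in> int_adjoin R a" and w: "w \<in> carrier R"
    and sum: "a [^] (2::nat) = e \<oplus> w"
  shows "ring_commute R e w"
proof -
  interpret comm_eval R "\<lambda>f. int_poly_eval R f a" by (rule comm_eval_int_poly(1)[OF a])
  define x :: "int poly" where "x = [:0, 1:]"
  have x: "int_poly_eval R x a = a" unfolding x_def by (rule comm_eval_int_poly(2)[OF a])
  obtain f where f: "e = int_poly_eval R f a" using e by (auto simp: int_adjoin_def)
  have "w = a [^] (2::nat) \<ominus> e"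
    using sum w f by (simp add: minus_eq a_assoc a_comm[of _ w] r_neg)
  also have "\<dots> = int_poly_eval R (x\<^sup>2 - f) a" by (simp add: h_diff h_power x f)
  finally show ?thesis unfolding ring_commute_def f by (simp only: h_commute)
qed

end

theorem theorem3p4:
  fixes R :: "('a, 'b) ring_scheme"
  assumes "ring R"
  shows "(zhou_nil_clean R
            \<longleftrightarrow> (\<forall>a \<in> carrier R. \<exists>e w. e \<in> int_adjoin R a \<and> ring_two_idempotent R e \<and>
                   ring_nilpotent R w \<and> a [^]\<^bsub>R\<^esub> (2::nat) = e \<oplus>\<^bsub>R\<^esub> w))
       \<and> (zhou_nil_clean R
            \<longleftrightarrow> (\<forall>a \<in> carrier R. \<exists>e w. ring_two_idempotent R e \<and> ring_nilpotent R w \<and>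
                   ring_commute R e w \<and> a [^]\<^bsub>R\<^esub> (2::nat) = e \<oplus>\<^bsub>R\<^esub> w))"
    (is "(?one \<longleftrightarrow> ?two) \<and> (?one \<longleftrightarrow> ?three)")
proof -
  interpret ring R by (rule assms)
  have "?one \<Longrightarrow> ?two"
    using zhou_nil_clean_imp_fifth_power_nil fifth_power_nil_imp_square_decomposition by blast
  moreover have "?two \<Longrightarrow> ?three"
    using commute_of_int_adjoin unfolding ring_nilpotent_def by meson
  moreover have "?three \<Longrightarrow> ?one"
    using square_decomposition_imp_fifth_power_nil fifth_power_nil_imp_zhou_nil_clean by blast
  ultimately show ?thesis by blast
qed

end
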